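(* Let $n,m$ be integers with $1\le m\le n$, let $k\ge 1$, and let $p(z)=a_0+\sum_{\nu=m}^{n}a_\nu z^\nu$ be a polynomial of degree $n$ having no zeros in $|z|<k$. Let $0\le r\le R\le k$. Then for every real or complex number $\alpha$ with $|\alpha|\ge R$, $$\begin{aligned} \max_{|z|=R}|D_\alpha p(z)|\ \le\ & \frac{n\left(R^{m-1}|\alpha|+k^m\right)}{R^m+k^m}\left[\left(\frac{R^m+k^m}{r^m+k^m}\right)^{\frac{n}{m}}\max_{|z|=r}|p(z)|-\left(\left(\frac{R^m+k^m}{r^m+k^m}\right)^{\frac{n}{m}}-1\right)\min_{|z|=k}|p(z)|\right]\\ &-\frac{n\left(R^{m-1}|\alpha|-R^m\right)}{R^m+k^m}\min_{|z|=k}|p(z)|. \end{aligned}$$ Equality in this inequality holds for $p(z)=(z^m+k^m)^{\frac{n}{m}}$, where $n$ is a multiple of $m$.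
   Context: For a polynomial $p$ of degree $n$ with complex coefficients and a real or complex number $\alpha$, the polar derivative of $p$ with respect to $\alpha$ is $D_\alpha p(z)=np(z)+(\alpha-z)p'(z)$. *)

theory Defs
  imports "HOL-Analysis.Analysis" "HOL-Computational_Algebra.Polynomial"
begin

definition polar_deriv :: "complex \<Rightarrow> complex poly \<Rightarrow> complex poly" where
  "polar_deriv \<alpha> p = smult (of_nat (degree p)) p + [:\<alpha>, -1:] * pderiv p"

lemma poly_polar_deriv:
  "poly (polar_deriv \<alpha> p) z = of_nat (degree p) * poly p z + (\<alpha> - z) * poly (pderiv p) z"
  by (simp add: polar_deriv_def left_diff_distrib)

definition max_modulus :: "complex poly \<Rightarrow> real \<Rightarrow> real" where
  "max_modulus p r = (SUP z\<in>sphere 0 r. cmod (poly p z))"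

definition min_modulus :: "complex poly \<Rightarrow> real \<Rightarrow> real" where
  "min_modulus p r = (INF z\<in>sphere 0 r. cmod (poly p z))"

(* For r \<ge> 0 the supremum and infimum are attained, i.e. they are a maximum and a minimum. *)

lemma compact_modulus_image: "compact ((\<lambda>z. cmod (poly p z)) ` sphere 0 r)"
  by (intro compact_continuous_image continuous_intros compact_sphere)

lemma
  assumes "0 \<le> r"
  shows max_modulus_attained: "\<exists>z. cmod z = r \<and> cmod (poly p z) = max_modulus p r"
    and min_modulus_attained: "\<exists>z. cmod z = r \<and> cmod (poly p z) = min_modulus p r"
proof -
  let ?S = "(\<lambda>z. cmod (poly p z)) ` sphere 0 r"
  have "complex_of_real r \<in> sphere 0 r"
    using assms by simp
  then have ne: "?S \<noteq> {}"
    by blast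
  have bd: "bdd_above ?S" "bdd_below ?S" "closed ?S"
    using compact_modulus_image[of p r]
    by (auto intro: bounded_imp_bdd_above bounded_imp_bdd_below compact_imp_bounded compact_imp_closed)
  have "max_modulus p r \<in> ?S" "min_modulus p r \<in> ?S"
    unfolding max_modulus_def min_modulus_def
    using closed_contains_Sup[OF ne bd(1,3)] closed_contains_Inf[OF ne bd(2,3)] by auto
  then show "\<exists>z. cmod z = r \<and> cmod (poly p z) = max_modulus p r"
    and "\<exists>z. cmod z = r \<and> cmod (poly p z) = min_modulus p r"
    by force+
qed

lemma
  assumes "cmod z = r"
  shows modulus_le_max_modulus: "cmod (poly p z) \<le> max_modulus p r"
    and min_modulus_le_modulus: "min_modulus p r \<le> cmod (poly p z)"
proof -
  have z: "z \<in> sphere 0 r"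
    using assms by simp
  have "bounded ((\<lambda>z. cmod (poly p z)) ` sphere 0 r)"
    using compact_modulus_image by (rule compact_imp_bounded)
  then show "cmod (poly p z) \<le> max_modulus p r" "min_modulus p r \<le> cmod (poly p z)"
    unfolding max_modulus_def min_modulus_def
    using z by (auto intro: cSUP_upper cINF_lower bounded_imp_bdd_above bounded_imp_bdd_below)
qed

(* The polynomials a_0 + \<Sum>\<nu>=m..n. a_\<nu> z^\<nu> of degree n without zeros in the open disc |z| < k. *)
definition lacunary_nonvanishing :: "nat \<Rightarrow> nat \<Rightarrow> real \<Rightarrow> complex poly \<Rightarrow> bool" where
  "lacunary_nonvanishing n m k p \<longleftrightarrow>
     degree p = n \<and>
     (\<forall>\<nu>. 0 < \<nu> \<and> \<nu> < m \<longrightarrow> coeff p \<nu> = 0) \<and>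
     (\<forall>z. cmod z < k \<longrightarrow> poly p z \<noteq> 0)"

(* For m = 1 and R = 0 the power R ^ (m - 1) is 1. *)
definition polar_bound ::
  "nat \<Rightarrow> nat \<Rightarrow> real \<Rightarrow> real \<Rightarrow> real \<Rightarrow> complex \<Rightarrow> complex poly \<Rightarrow> real" where
  "polar_bound n m k r R \<alpha> p =
     real n * (R ^ (m - 1) * cmod \<alpha> + k ^ m) / (R ^ m + k ^ m) *
       (((R ^ m + k ^ m) / (r ^ m + k ^ m)) powr (real n / real m) * max_modulus p r
        - (((R ^ m + k ^ m) / (r ^ m + k ^ m)) powr (real n / real m) - 1) * min_modulus p k)
     - real n * (R ^ (m - 1) * cmod \<alpha> - R ^ m) / (R ^ m + k ^ m) * min_modulus p k"

(* (z^m + k^m)^(n/m); only meaningful when m divides n. *)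
definition extremal_poly :: "nat \<Rightarrow> nat \<Rightarrow> real \<Rightarrow> complex poly" where
  "extremal_poly n m k = (monom 1 m + [:complex_of_real (k ^ m):]) ^ (n div m)"

end

theory Submission
  imports Defs "HOL-Complex_Analysis.Conformal_Mappings"
begin

text \<open>
  For a zero-free p on |z| < k the quotient w = z p' / (n p) satisfies Re w \<le> 1/2, so w / (1 - w)
  maps the disc into the unit disc; it vanishes to order m at 0, and the Schwarz lemma gives
  k^m |p'| \<le> |z|^(m - 1) |n p - z p'| on |z| \<le> k. Applied to p - c with |c| \<le> min |p| on |z| = k
  this brings in the minimum; applied with m = 1 on |z| < R to p - c with |c| \<ge> max |p| on |z| = R
  it gives |n p - z p'| + R |p'| \<le> n max |p|. Since D p = (n p - z p') + \<alpha> p', the two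
  inequalities bound D p in terms of the maximum on |z| = R. To pass from R to r, the Schwarz
  estimate also yields Re w \<le> s^m / (s^m + k^m) on |z| = s, that is, |p| (s^m + k^m)^(-n/m)
  decreases along rays; again this is applied to p - c.
\<close>

subsection \<open>Values omitted by a polynomial on a disc\<close>

lemma degree_diff_const:
  assumes "0 < degree (p :: complex poly)"
  shows "degree (p - [:c:]) = degree p"
proof -
  have eq: "p - [:c:] = p + [:-c:]"
    by (simp add: poly_eq_poly_eq_iff[symmetric] fun_eq_iff)
  show ?thesis
    unfolding eq using assms by (intro degree_add_eq_left) simp
qed

text \<open>Only the constant coefficient changes, so degree and gap survive and the derivative
  stays the same. Estimates for zero-free polynomials thus become families of estimates, one for
  each omitted value c.\<close>

lemma lacunary_nonvanishing_diff_const: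
  assumes "lacunary_nonvanishing n m k p" and "1 \<le> n"
    and "\<And>z. cmod z < k' \<Longrightarrow> poly p z \<noteq> c"
  shows "lacunary_nonvanishing n m k' (p - [:c:])"
  using assms by (auto simp: lacunary_nonvanishing_def degree_diff_const coeff_pCons split: nat.split)

lemma pderiv_diff_const: "pderiv (p - [:c:]) = pderiv (p :: complex poly)"
  by (simp add: pderiv_diff pderiv_pCons)

text \<open>Openness of the image makes the weak inequalities of the maximum and minimum principles
  strict, so that values c of exactly extremal modulus are omitted as well.\<close>

lemma open_poly_image_ball:
  assumes "0 < degree (p :: complex poly)" and "0 < k"
  shows "open (poly p ` ball 0 k)"
proof (rule open_mapping_thm[where S = "ball 0 k"])
  show "\<not> poly p constant_on ball 0 k"
  proof
    assume "poly p constant_on ball 0 k"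
    then obtain c where c: "\<And>z. z \<in> ball 0 k \<Longrightarrow> poly p z = c"
      by (auto simp: constant_on_def)
    have "p - [:c:] = 0"
    proof (rule ccontr)
      assume "p - [:c:] \<noteq> 0"
      then have "finite {z. poly (p - [:c:]) z = 0}"
        by (rule poly_roots_finite)
      moreover have "ball 0 k \<subseteq> {z. poly (p - [:c:]) z = 0}"
        using c by auto
      ultimately have "finite (ball (0::complex) k)"
        by (rule finite_subset[rotated])
      then show False
        using uncountable_ball[OF assms(2), of "0::complex"] countable_finite by blast
    qed
    then have "p = [:c:]"
      by simp
    then show False
      using assms(1) by simp
  qed
qed (auto intro!: holomorphic_intros)

lemma poly_ne_of_max_modulus_le:
  assumes "0 < degree p" and "0 < R" and "max_modulus p R \<le> cmod c" and "cmod z < R"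
  shows "poly p z \<noteq> c"
proof -
  have "cmod (poly p w) \<le> max_modulus p R" if "w \<in> ball 0 R" for w
    by (rule maximum_modulus_frontier[where S = "ball 0 R" and f = "poly p"])
      (use that assms(2) in \<open>auto intro!: holomorphic_intros continuous_intros modulus_le_max_modulus\<close>)
  then have "poly p ` ball 0 R \<subseteq> interior (cball 0 (max_modulus p R))"
    using open_poly_image_ball[OF assms(1,2)] by (intro interior_maximal) auto
  then have "poly p z \<in> ball 0 (max_modulus p R)"
    using assms(4) by (simp add: image_subset_iff)
  then show ?thesis
    using assms(3) by auto
qed

lemma min_modulus_nonneg: "0 \<le> k \<Longrightarrow> 0 \<le> min_modulus p k"
  using min_modulus_attained[of k p] by (metis norm_ge_zero)

text \<open>The maximum principle for 1 / p, which is continuous up to the circle once the minimum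
  there is positive.\<close>

lemma min_modulus_le_modulus_cball:
  assumes "\<And>z. cmod z < k \<Longrightarrow> poly p z \<noteq> 0" and "0 < k" and "cmod z \<le> k"
  shows "min_modulus p k \<le> cmod (poly p z)"
proof (cases "min_modulus p k = 0")
  case False
  then have pos: "0 < min_modulus p k"
    using min_modulus_nonneg[of k p] assms(2) by simp
  have nz: "poly p w \<noteq> 0" if "cmod w \<le> k" for w
    using assms(1)[of w] min_modulus_le_modulus[of w k p] pos that by (cases "cmod w < k") auto
  have "cmod (inverse (poly p z)) \<le> inverse (min_modulus p k)"
  proof (rule maximum_modulus_frontier[where S = "cball 0 k" and f = "\<lambda>w. inverse (poly p w)"])
    show "(\<lambda>w. inverse (poly p w)) holomorphic_on interior (cball 0 k)"
      using nz by (auto intro!: holomorphic_intros)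
    show "continuous_on (closure (cball 0 k)) (\<lambda>w. inverse (poly p w))"
      using nz by (auto intro!: continuous_intros)
    show "cmod (inverse (poly p w)) \<le> inverse (min_modulus p k)" if "w \<in> frontier (cball 0 k)" for w
      using that pos min_modulus_le_modulus[of w k p]
      by (simp add: norm_inverse le_imp_inverse_le)
  qed (use assms in auto)
  then show ?thesis
    using pos nz[OF assms(3)] by (simp add: norm_inverse)
qed simp

lemma poly_ne_of_le_min_modulus:
  assumes "0 < degree p" and "0 < k" and nz: "\<And>z. cmod z < k \<Longrightarrow> poly p z \<noteq> 0"
    and "cmod c \<le> min_modulus p k" and "cmod z < k"
  shows "poly p z \<noteq> c"
proof (cases "c = 0")
  case False
  \<comment> \<open>The closure of an open ball is the closed ball only for positive radius, hence
    the separate case c = 0.\<close>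
  then have pos: "min_modulus p k > 0"
    using assms(4) by (smt (verit) zero_less_norm_iff)
  have "poly p ` ball 0 k \<subseteq> interior (- ball 0 (min_modulus p k))"
    using open_poly_image_ball[OF assms(1,2)] min_modulus_le_modulus_cball[OF nz assms(2)]
    by (intro interior_maximal image_subsetI) (simp_all add: not_less)
  also have "\<dots> = - cball 0 (min_modulus p k)"
    using pos by (simp add: interior_complement)
  finally have "poly p z \<in> - cball 0 (min_modulus p k)"
    using assms(5) by (simp add: image_subset_iff)
  then show ?thesis
    using assms(4) by auto
qed (use nz assms(5) in auto)

subsection \<open>Estimates for the derivative\<close>

text \<open>The quotient z p' / p is the sum of z / (z - a) over the zeros a, and each term has real
  part at most 1/2 since |z| < k \<le> |a|. The induction splits off one linear factor at a
  time.\<close>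

lemma Re_log_deriv_le:
  assumes "\<And>z. cmod z < k \<Longrightarrow> poly p z \<noteq> 0" and "cmod z < k"
  shows "2 * Re (z * poly (pderiv p) z / poly p z) \<le> real (degree p)"
  using assms(1)
proof (induction "degree p" arbitrary: p)
  case 0
  then have "pderiv p = 0"
    by (simp add: pderiv_eq_0_iff)
  then show ?case
    by simp
next
  case (Suc d)
  have "\<exists>i\<in>{1..degree p}. coeff p i \<noteq> 0"
    using Suc.hyps(2) by (intro bexI[of _ "degree p"]) auto
  then obtain a where a: "poly p a = 0"
    using fundamental_theorem_of_algebra[of "coeff p" "degree p"] unfolding poly_altdef by blast
  then obtain q where q: "p = [:-a, 1:] * q"
    by (auto simp: poly_eq_0_iff_dvd)
  have "q \<noteq> 0"
    using Suc.hyps(2) q by auto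
  then have "degree p = degree [:-a, 1:] + degree q"
    unfolding q by (intro degree_mult_eq) auto
  then have deg: "d = degree q"
    using Suc.hyps(2) by simp
  have nzq: "poly q w \<noteq> 0" if "cmod w < k" for w
    using Suc.prems[OF that] q by auto
  have ka: "k \<le> cmod a"
    using a Suc.prems[of a] by (meson not_le)
  have za: "z - a \<noteq> 0"
    using ka assms(2) by auto
  \<comment> \<open>Multiplied by |z - a|^2 this reads |z|^2 \<le> |a|^2.\<close>
  have "2 * Re (z / (z - a)) \<le> 1"
  proof -
    have "(Re z)\<^sup>2 + (Im z)\<^sup>2 \<le> (Re a)\<^sup>2 + (Im a)\<^sup>2"
      using ka assms(2) by (simp flip: cmod_power2)
    moreover have "(Re (z - a))\<^sup>2 + (Im (z - a))\<^sup>2 > 0"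
      using za by (simp add: complex_eq_iff sum_power2_gt_zero_iff)
    ultimately show ?thesis
      by (simp add: Re_divide divide_le_eq power2_eq_square algebra_simps)
  qed
  moreover have "z * poly (pderiv p) z / poly p z = z / (z - a) + z * poly (pderiv q) z / poly q z"
  proof -
    have "poly (pderiv p) z = poly q z + (z - a) * poly (pderiv q) z"
      unfolding q pderiv_mult by (simp add: pderiv_pCons algebra_simps)
    moreover have "poly p z = (z - a) * poly q z"
      by (simp add: q algebra_simps)
    ultimately show ?thesis
      using nzq[OF assms(2)] za by (simp only:) (simp add: field_simps)
  qed
  moreover have "2 * Re (z * poly (pderiv q) z / poly q z) \<le> real d"
    using Suc.hyps(1)[OF deg nzq] deg by simp
  ultimately show ?case
    using Suc.hyps(2) by simp
qed

text \<open>With w = z p' / p and n the degree, the half-plane Re w \<le> n / 2 consists of the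
  points at least as close to 0 as to n, and it does not contain n.\<close>

lemma deriv_reciprocal_bound:
  assumes "\<And>z. cmod z < k \<Longrightarrow> poly p z \<noteq> 0" and "cmod z < k" and "0 < degree p"
  shows "cmod (z * poly (pderiv p) z)
      \<le> cmod (of_nat (degree p) * poly p z - z * poly (pderiv p) z)" (is ?le)
    and "of_nat (degree p) * poly p z - z * poly (pderiv p) z \<noteq> 0" (is ?nz)
proof -
  let ?n = "real (degree p)"
  define w where "w = z * poly (pderiv p) z / poly p z"
  have nz: "poly p z \<noteq> 0"
    using assms(1,2) by blast
  have w: "2 * Re w \<le> ?n"
    unfolding w_def using Re_log_deriv_le[OF assms(1,2)] by simp
  have X: "z * poly (pderiv p) z = w * poly p z"
    using nz by (simp add: w_def)
  have Y: "of_nat (degree p) * poly p z - z * poly (pderiv p) z = (of_nat (degree p) - w) * poly p z"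
    unfolding X by (simp add: algebra_simps)
  \<comment> \<open>The two squares differ by n^2 - 2 n Re w.\<close>
  have "(cmod w)\<^sup>2 \<le> (cmod (of_nat (degree p) - w))\<^sup>2"
    unfolding cmod_power2 using mult_left_mono[OF w, of ?n]
    by (simp add: power2_eq_square algebra_simps)
  then have "cmod w \<le> cmod (of_nat (degree p) - w)"
    by (rule power2_le_imp_le) simp
  then show ?le
    unfolding Y unfolding X norm_mult by (rule mult_right_mono) simp
  have "of_nat (degree p) - w \<noteq> 0"
  proof
    assume "of_nat (degree p) - w = 0"
    then have "Re w = ?n"
      by (simp add: complex_eq_iff)
    then show False
      using w assms(3) by simp
  qed
  then show ?nz
    unfolding Y using nz by simp
qed

lemma lacunary_deriv_bound:
  assumes p: "lacunary_nonvanishing n m k p" and "1 \<le> m" and "1 \<le> n" and "0 < k" and "cmod z \<le> k"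
  shows "k ^ m * cmod (poly (pderiv p) z)
    \<le> cmod z ^ (m - 1) * cmod (of_nat n * poly p z - z * poly (pderiv p) z)"
proof -
  have deg: "degree p = n" and nz: "\<And>z. cmod z < k \<Longrightarrow> poly p z \<noteq> 0"
    and lac: "\<And>\<nu>. 0 < \<nu> \<Longrightarrow> \<nu> < m \<Longrightarrow> coeff p \<nu> = 0"
    using p by (auto simp: lacunary_nonvanishing_def)
  define D where "D z = of_nat n * poly p z - z * poly (pderiv p) z" for z
  \<comment> \<open>The gap gives p' a zero of order at least m - 1 at the origin; the factor z in z
    p' supplies one more.\<close>
  have "monom 1 (m - 1) dvd pderiv p"
    using lac by (auto simp: monom_1_dvd_iff' coeff_pderiv)
  then obtain g where g: "pderiv p = monom 1 (m - 1) * g"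
    by blast
  have pg: "poly (pderiv p) z = z ^ (m - 1) * poly g z" for z
    by (simp add: g poly_monom)
  have Dnz: "D z \<noteq> 0" if "cmod z < k" for z
    using deriv_reciprocal_bound(2)[OF nz that] deg assms(3) by (simp add: D_def)
  have gD: "cmod z ^ m * cmod (poly g z) \<le> cmod (D z)" if "cmod z < k" for z
  proof -
    have "cmod (z * poly (pderiv p) z) \<le> cmod (D z)"
      using deriv_reciprocal_bound(1)[OF nz that] deg assms(3) by (simp add: D_def)
    moreover have "cmod (z * poly (pderiv p) z) = cmod z ^ m * cmod (poly g z)"
      using assms(2) by (simp add: pg norm_mult norm_power power_eq_if[of "cmod z" m])
    ultimately show ?thesis
      by simp
  qed
  \<comment> \<open>Schwarz' lemma with a zero of order m at the origin, via the maximum principle for g / D on smaller discs.\<close>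
  have step: "s ^ m * cmod (poly g w) \<le> cmod (D w)" if "cmod w < s" "s < k" for s w
  proof -
    have s: "0 < s"
      using that(1) by (smt (verit) norm_ge_zero)
    have "cmod (poly g w / D w) \<le> 1 / s ^ m"
    proof (rule maximum_modulus_frontier[where S = "cball 0 s" and f = "\<lambda>w. poly g w / D w"])
      show "(\<lambda>w. poly g w / D w) holomorphic_on interior (cball 0 s)"
        using Dnz that(2) unfolding D_def by (auto intro!: holomorphic_intros)
      show "continuous_on (closure (cball 0 s)) (\<lambda>w. poly g w / D w)"
        using Dnz that(2) unfolding D_def by (auto intro!: continuous_intros)
      show "cmod (poly g v / D v) \<le> 1 / s ^ m" if "v \<in> frontier (cball 0 s)" for v
        using that gD[of v] Dnz[of v] s \<open>s < k\<close> by (simp add: norm_divide field_simps)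
    qed (use that in auto)
    then show ?thesis
      using Dnz[of w] that s by (simp add: norm_divide field_simps)
  qed
  \<comment> \<open>Here w is fixed and s tends to k.\<close>
  have open_case: "k ^ m * cmod (poly g w) \<le> cmod (D w)" if "cmod w < k" for w
  proof -
    have "k ^ m * cmod (poly g w) - cmod (D w) \<le> 0"
      by (rule continuous_le_on_closure[where S = "{cmod w<..<k}"
            and f = "\<lambda>s. s ^ m * cmod (poly g w) - cmod (D w)"])
        (use that step[of w] in \<open>auto intro!: continuous_intros\<close>)
    then show ?thesis
      by simp
  qed
  \<comment> \<open>Extension to the circle |z| = k. The inequality is kept free of division because
    \<open>D\<close> may vanish there, for instance at a multiple zero of p.\<close>
  have "k ^ m * cmod (poly g z) - cmod (D z) \<le> 0"
    by (rule continuous_le_on_closure[where S = "ball 0 k"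
          and f = "\<lambda>z. k ^ m * cmod (poly g z) - cmod (D z)"])
      (use assms(4,5) open_case in \<open>auto simp: D_def intro!: continuous_intros\<close>)
  then have "cmod z ^ (m - 1) * (k ^ m * cmod (poly g z)) \<le> cmod z ^ (m - 1) * cmod (D z)"
    by (intro mult_left_mono) auto
  then show ?thesis
    by (simp add: pg D_def norm_mult norm_power mult_ac)
qed

text \<open>Unlike \<open>sgn z\<close>, the direction u is a unit even for z = 0, which spares case
  distinctions when c is aligned with a given number.\<close>

lemma exists_unit_direction: "\<exists>u. cmod u = 1 \<and> z = of_real (cmod z) * u"
proof (cases "z = 0")
  case True
  then show ?thesis
    by (intro exI[of _ 1]) simp
next
  case False
  then show ?thesis
    by (intro exI[of _ "sgn z"]) (simp add: sgn_eq norm_divide)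
qed

lemma deriv_bound_min_modulus:
  assumes p: "lacunary_nonvanishing n m k p" and "1 \<le> m" and "1 \<le> n" and "0 < k" and "cmod z \<le> k"
  shows "k ^ m * cmod (poly (pderiv p) z)
    \<le> cmod z ^ (m - 1) * (cmod (of_nat n * poly p z - z * poly (pderiv p) z) - n * min_modulus p k)"
proof -
  define X where "X = of_nat n * poly p z - z * poly (pderiv p) z"
  define \<mu> where "\<mu> = min_modulus p k"
  have deg: "degree p = n" and nz: "\<And>z. cmod z < k \<Longrightarrow> poly p z \<noteq> 0"
    using p by (auto simp: lacunary_nonvanishing_def)
  have \<mu>: "0 \<le> \<mu>" "\<mu> \<le> cmod (poly p z)"
    using min_modulus_nonneg[of k p] min_modulus_le_modulus_cball[OF nz] assms by (auto simp: \<mu>_def)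
  have key: "k ^ m * cmod (poly (pderiv p) z) \<le> cmod z ^ (m - 1) * cmod (X - of_nat n * c)"
    if "cmod c \<le> \<mu>" for c
  proof -
    have "lacunary_nonvanishing n m k (p - [:c:])"
      using poly_ne_of_le_min_modulus[of p k c] nz deg assms that
      by (intro lacunary_nonvanishing_diff_const[OF p]) (auto simp: \<mu>_def)
    from lacunary_deriv_bound[OF this assms(2-5)] show ?thesis
      by (simp add: pderiv_diff_const X_def algebra_simps)
  qed
  \<comment> \<open>The constant c is taken in the direction u of X, which makes |X - n c| as small as possible.\<close>
  obtain u where u: "cmod u = 1" "X = of_real (cmod X) * u"
    using exists_unit_direction by blast
  \<comment> \<open>Otherwise c = X / n would be admissible and force p' = 0; but then X = n p has
    modulus at least n \<mu>.\<close>
  have "n * \<mu> \<le> cmod X"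
  proof (rule ccontr)
    assume *: "\<not> n * \<mu> \<le> cmod X"
    then have "cmod (X / of_nat n) \<le> \<mu>"
      using assms(3) by (simp add: norm_divide field_simps)
    from key[OF this] have "k ^ m * cmod (poly (pderiv p) z) \<le> 0"
      using assms(3) by simp
    then have "poly (pderiv p) z = 0"
      using zero_less_power[OF assms(4), of m] by (auto simp: mult_le_0_iff)
    then have "cmod X = n * cmod (poly p z)"
      by (simp add: X_def norm_mult)
    then show False
      using * mult_left_mono[OF \<mu>(2), of "real n"] by simp
  qed
  moreover have "X - of_nat n * (of_real \<mu> * u) = of_real (cmod X - n * \<mu>) * u"
    by (subst u(2)) (simp add: algebra_simps)
  then have "cmod (X - of_nat n * (of_real \<mu> * u)) = \<bar>cmod X - n * \<mu>\<bar>"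
    by (simp only: norm_mult u(1) norm_of_real mult_1_right)
  moreover have "cmod (of_real \<mu> * u) \<le> \<mu>"
    using \<mu>(1) u(1) by (simp add: norm_mult)
  from key[OF this]
  have "k ^ m * cmod (poly (pderiv p) z)
      \<le> cmod z ^ (m - 1) * cmod (X - of_nat n * (of_real \<mu> * u))" .
  ultimately show ?thesis
    unfolding X_def \<mu>_def by simp
qed

text \<open>Counterpart of \<open>deriv_bound_min_modulus\<close> with large constants: p omits
  every c with |c| \<ge> M on |z| < R, and c = M u in the direction u of X turns |X - n c| into n M
  - |X|.\<close>

lemma deriv_add_reciprocal_deriv_le:
  assumes "degree p = n" and "1 \<le> n" and "cmod z = R"
  shows "cmod (of_nat n * poly p z - z * poly (pderiv p) z) + R * cmod (poly (pderiv p) z)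
    \<le> n * max_modulus p R"
proof (cases "R = 0")
  case True
  then show ?thesis
    using assms modulus_le_max_modulus[of z R p] by (simp add: norm_mult mult_left_mono)
next
  case False
  then have R: "0 < R"
    using assms(3) by (metis norm_ge_zero less_eq_real_def)
  define X where "X = of_nat n * poly p z - z * poly (pderiv p) z"
  define M where "M = max_modulus p R"
  have M: "cmod (poly p z) \<le> M"
    using modulus_le_max_modulus[OF assms(3)] by (simp add: M_def)
  then have M0: "0 \<le> M"
    by (rule order_trans[OF norm_ge_zero])
  \<comment> \<open>For m = 1 the gap condition is vacuous. The point z lies on the boundary of the
    disc of radius R, so the closed-disc form of \<open>lacunary_deriv_bound\<close> is
    essential.\<close>
  have key: "R * cmod (poly (pderiv p) z) \<le> cmod (X - of_nat n * c)" if "M \<le> cmod c" for c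
  proof -
    have "lacunary_nonvanishing n 1 R (p - [:c:])"
      using poly_ne_of_max_modulus_le[of p R c] assms R that
      by (auto simp: lacunary_nonvanishing_def degree_diff_const M_def)
    from lacunary_deriv_bound[OF this _ assms(2) R] show ?thesis
      using assms(3) by (simp add: pderiv_diff_const X_def algebra_simps)
  qed
  obtain u where u: "cmod u = 1" "X = of_real (cmod X) * u"
    using exists_unit_direction by blast
  \<comment> \<open>Otherwise c = X / n would again force p' = 0, and X = n p has modulus at most n
    M.\<close>
  have "cmod X \<le> n * M"
  proof (rule ccontr)
    assume *: "\<not> cmod X \<le> n * M"
    then have "M \<le> cmod (X / of_nat n)"
      using assms(2) by (simp add: norm_divide field_simps)
    from key[OF this] have "R * cmod (poly (pderiv p) z) \<le> 0"
      using assms(2) by simp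
    then have "poly (pderiv p) z = 0"
      using R by (simp add: mult_le_0_iff)
    then have "cmod X = n * cmod (poly p z)"
      by (simp add: X_def norm_mult)
    then show False
      using * mult_left_mono[OF M, of "real n"] by simp
  qed
  moreover have "X - of_nat n * (of_real M * u) = of_real (cmod X - n * M) * u"
    by (subst u(2)) (simp add: algebra_simps)
  then have "cmod (X - of_nat n * (of_real M * u)) = \<bar>cmod X - n * M\<bar>"
    by (simp only: norm_mult u(1) norm_of_real mult_1_right)
  moreover have "M \<le> cmod (of_real M * u)"
    using M0 u(1) by (simp add: norm_mult)
  from key[OF this]
  have "R * cmod (poly (pderiv p) z) \<le> cmod (X - of_nat n * (of_real M * u))" .
  ultimately show ?thesis
    unfolding X_def M_def by simp
qed

subsection \<open>Growth along rays\<close>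

text \<open>The hypothesis describes an Apollonius disc, or a half-plane when t = 1; its largest
  real part is t / (1 + t).\<close>

lemma Re_le_of_norm_le:
  assumes "cmod w \<le> t * cmod (1 - w)" and "0 \<le> t" and "t \<le> 1"
  shows "(1 + t) * Re w \<le> t"
proof (rule ccontr)
  assume neg: "\<not> (1 + t) * Re w \<le> t"
  then have x: "0 < Re w"
    using assms(2) by (smt (verit) mult_nonneg_nonpos)
  have "(cmod w)\<^sup>2 \<le> (t * cmod (1 - w))\<^sup>2"
    using assms by (intro power_mono) auto
  then have "(Re w)\<^sup>2 + (Im w)\<^sup>2 \<le> t\<^sup>2 * ((1 - Re w)\<^sup>2 + (Im w)\<^sup>2)"
    by (simp add: power_mult_distrib cmod_power2)
  moreover have "t\<^sup>2 * (Im w)\<^sup>2 \<le> 1 * (Im w)\<^sup>2"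
    using assms(2,3) by (intro mult_right_mono) (auto simp: power_le_one)
  ultimately have "(Re w)\<^sup>2 \<le> t\<^sup>2 * (1 - Re w)\<^sup>2"
    by (simp add: algebra_simps)
  \<comment> \<open>Factorisation of x^2 - t^2 (1 - x)^2 with x = Re w.\<close>
  then have "((1 + t) * Re w - t) * ((1 - t) * Re w + t) \<le> 0"
    by (simp add: power2_eq_square algebra_simps)
  moreover have "0 < (1 - t) * Re w + t"
    using x assms by (cases "t = 0") (auto intro: add_nonneg_pos)
  ultimately show False
    using neg by (simp add: mult_le_0_iff)
qed

text \<open>\<open>Re_le_of_norm_le\<close> for w = z p' / (n p) and t = (|z| / k)^m. The factor
  \<open>cnj (poly p z)\<close> replaces division by p, matching the radial derivative of
  |p|^2.\<close>

lemma Re_log_deriv_lacunary_le: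
  assumes p: "lacunary_nonvanishing n m k p" and "1 \<le> m" and "1 \<le> n" and "cmod z < k"
  shows "(cmod z ^ m + k ^ m) * Re (cnj (poly p z) * (z * poly (pderiv p) z))
    \<le> n * cmod z ^ m * (cmod (poly p z))\<^sup>2"
proof -
  have k: "0 < k"
    using assms(4) by (smt (verit) norm_ge_zero)
  have nz: "poly p z \<noteq> 0"
    using assms by (auto simp: lacunary_nonvanishing_def)
  define w where "w = z * poly (pderiv p) z / (of_nat n * poly p z)"
  have X: "z * poly (pderiv p) z = w * (of_nat n * poly p z)"
    using nz assms(3) by (simp add: w_def)
  define t where "t = (cmod z / k) ^ m"
  have t: "0 \<le> t" "t \<le> 1"
    using assms(4) k by (auto simp: t_def intro!: power_le_one)
  have tk: "t * k ^ m = cmod z ^ m"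
    using k by (simp add: t_def power_divide)
  have "k ^ m * cmod (poly (pderiv p) z)
      \<le> cmod z ^ (m - 1) * cmod (of_nat n * poly p z - z * poly (pderiv p) z)"
    using lacunary_deriv_bound[OF p assms(2,3) k] assms(4) by simp
  then have "cmod z * (k ^ m * cmod (poly (pderiv p) z))
      \<le> cmod z * (cmod z ^ (m - 1) * cmod (of_nat n * poly p z - z * poly (pderiv p) z))"
    by (rule mult_left_mono) simp
  then have "k ^ m * cmod (z * poly (pderiv p) z)
      \<le> cmod z ^ m * cmod (of_nat n * poly p z - z * poly (pderiv p) z)"
    using assms(2) by (simp add: norm_mult power_eq_if[of "cmod z" m] mult_ac)
  also have "of_nat n * poly p z - z * poly (pderiv p) z = (1 - w) * (of_nat n * poly p z)"
    unfolding X by (simp add: algebra_simps)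
  finally have "(k ^ m * (n * cmod (poly p z))) * cmod w
      \<le> (k ^ m * (n * cmod (poly p z))) * (t * cmod (1 - w))"
    unfolding X tk[symmetric] by (simp add: norm_mult mult_ac)
  then have "cmod w \<le> t * cmod (1 - w)"
    by (rule mult_left_le_imp_le) (use k nz assms(3) in auto)
  then have "(1 + t) * Re w \<le> t"
    using t by (rule Re_le_of_norm_le)
  then have "(k ^ m * n * (cmod (poly p z))\<^sup>2) * ((1 + t) * Re w)
      \<le> (k ^ m * n * (cmod (poly p z))\<^sup>2) * t"
    using k by (intro mult_left_mono) auto
  moreover have "cnj (poly p z) * (z * poly (pderiv p) z) = of_real (n * (cmod (poly p z))\<^sup>2) * w"
    unfolding X of_real_mult complex_norm_square by simp
  then have "Re (cnj (poly p z) * (z * poly (pderiv p) z)) = n * (cmod (poly p z))\<^sup>2 * Re w"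
    by (simp only: Re_complex_of_real Im_complex_of_real times_complex.sel)
  ultimately show ?thesis
    unfolding tk[symmetric] by (simp add: algebra_simps)
qed

text \<open>On the ray through u the logarithmic derivative of |p|^2 is at most that of (s^m +
  k^m)^(2n/m), so their quotient \<open>\<psi>\<close> decreases. The square is used because it is
  differentiable everywhere.\<close>

lemma norm_poly_radial_growth:
  assumes p: "lacunary_nonvanishing n m k p" and "1 \<le> m" and "1 \<le> n" and "0 < k"
    and "0 \<le> r" and "r \<le> R" and "R \<le> k" and u: "cmod u = 1"
  shows "cmod (poly p (of_real R * u))
    \<le> ((R ^ m + k ^ m) / (r ^ m + k ^ m)) powr (real n / real m) * cmod (poly p (of_real r * u))"
proof -
  define e where "e = real n / real m"
  define b where "b s = s ^ m + k ^ m" for s :: real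
  define \<phi> where "\<phi> s = (cmod (poly p (of_real s * u)))\<^sup>2" for s
  define \<phi>' where "\<phi>' s = 2 * Re (cnj (poly p (of_real s * u)) * (u * poly (pderiv p) (of_real s * u)))" for s
  have b: "0 < b s" if "0 \<le> s" for s
    using that assms(4) by (auto simp: b_def intro: add_nonneg_pos)
  have d\<phi>: "(\<phi> has_real_derivative \<phi>' s) (at s)" for s
  proof -
    have "((\<lambda>s. poly p (of_real s * u)) has_vector_derivative u * poly (pderiv p) (of_real s * u)) (at s)"
      by (rule field_vector_diff_chain_at[where g = "poly p" and f = "\<lambda>s. of_real s * u", unfolded o_def])
        (auto intro!: derivative_eq_intros poly_DERIV)
    then have "((\<lambda>s. poly p (of_real s * u) \<bullet> poly p (of_real s * u)) has_derivative
        (\<lambda>h. h * \<phi>' s)) (at s)"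
      unfolding has_vector_derivative_def
      by (auto intro!: derivative_eq_intros simp: \<phi>'_def inner_complex_def fun_eq_iff algebra_simps)
    then show ?thesis
      unfolding \<phi>_def has_field_derivative_def
      by (simp add: power2_norm_eq_inner mult_commute_abs)
  qed
  have db: "(b has_real_derivative real m * s ^ (m - 1)) (at s)" for s
    unfolding b_def by (auto intro!: derivative_eq_intros)
  define \<psi> where "\<psi> s = \<phi> s * b s powr (- 2 * e)" for s
  have "\<psi> R \<le> \<psi> r"
  \<comment> \<open>Only interior points need a derivative, so 0 < s < k: a factor s can be
    cancelled, and s stays where the strict bound |z| < k holds.\<close>
  proof (rule DERIV_nonpos_imp_decreasing_open[OF assms(6)])
    show "continuous_on {r..R} \<psi>"
    proof -
      have "s ^ m + k ^ m \<noteq> 0" if "s \<in> {r..R}" for s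
        using b[of s] that assms(5) by (simp add: b_def)
      then show ?thesis
        unfolding \<psi>_def \<phi>_def b_def by (intro continuous_intros) auto
    qed
  next
    fix s assume s: "r < s" "s < R"
    then have s0: "0 < s" "s < k"
      using assms by auto
    define d where "d = \<phi>' s * b s powr (- 2 * e)
        + \<phi> s * ((- 2 * e) * b s powr (- 2 * e - 1) * (real m * s ^ (m - 1)))"
    have "(\<psi> has_real_derivative d) (at s)"
      unfolding \<psi>_def d_def using b[of s] s0
      by (auto intro!: derivative_eq_intros d\<phi> db simp: powr_diff field_simps)
    moreover have "d \<le> 0"
    proof -
      define T where "T = Re (cnj (poly p (of_real s * u)) * (of_real s * u * poly (pderiv p) (of_real s * u)))"
      have "b s * T \<le> n * s ^ m * \<phi> s"
        using Re_log_deriv_lacunary_le[OF p assms(2,3), of "of_real s * u"] s0 u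
        by (simp add: norm_mult \<phi>_def b_def T_def)
      moreover have "s * \<phi>' s = 2 * T"
        by (simp add: \<phi>'_def T_def algebra_simps)
      ultimately have "b s * (s * \<phi>' s) \<le> 2 * (n * s ^ m * \<phi> s)"
        by simp
      also have "s ^ m = s * s ^ (m - 1)"
        using assms(2) by (simp add: power_eq_if[of s m])
      finally have "s * (b s * \<phi>' s) \<le> s * (2 * n * s ^ (m - 1) * \<phi> s)"
        by (simp add: mult_ac)
      then have *: "b s * \<phi>' s - 2 * n * s ^ (m - 1) * \<phi> s \<le> 0"
        using s0 by simp
      have "d = b s powr (- 2 * e - 1) * (b s * \<phi>' s - 2 * n * s ^ (m - 1) * \<phi> s)"
      proof -
        have "b s powr (- 2 * e) = b s powr (- 2 * e - 1) * b s"
          using b[of s] s0 by (simp add: powr_diff)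
        moreover have "e * real m = n"
          using assms(2) by (simp add: e_def)
        ultimately show ?thesis
          unfolding d_def by (simp add: algebra_simps flip: \<open>e * real m = n\<close>)
      qed
      also have "\<dots> \<le> 0"
        using * by (intro mult_nonneg_nonpos) auto
      finally show ?thesis .
    qed
    ultimately show "\<exists>y. (\<psi> has_real_derivative y) (at s) \<and> y \<le> 0"
      by blast
  qed
  then have "\<phi> R / b R powr (2 * e) \<le> \<phi> r / b r powr (2 * e)"
    by (simp add: \<psi>_def powr_minus divide_inverse)
  moreover have "0 < b R powr (2 * e)"
    using b[of R] assms(5,6) by simp
  ultimately have "\<phi> R \<le> b R powr (2 * e) / b r powr (2 * e) * \<phi> r"
    by (simp add: pos_divide_le_eq mult.commute)
  also have "b R powr (2 * e) / b r powr (2 * e) = (b R / b r) powr (2 * e)"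
    using b[of R] b[of r] assms(5,6) by (simp add: powr_divide)
  also have "(b R / b r) powr (2 * e) * \<phi> r = ((b R / b r) powr e * cmod (poly p (of_real r * u)))\<^sup>2"
    unfolding \<phi>_def power_mult_distrib by (simp only: mult_2 powr_add power2_eq_square)
  finally show ?thesis
    unfolding \<phi>_def b_def e_def by (rule power2_le_imp_le) simp
qed

text \<open>The growth estimate is applied to p - c on the ray through a maximum point on |z| = R.
  With c aligned with y = p(r u), the inner value loses exactly \<mu>, while the outer value loses
  at most \<mu>.\<close>

lemma max_modulus_growth:
  assumes p: "lacunary_nonvanishing n m k p" and "1 \<le> m" and "1 \<le> n" and "0 < k"
    and "0 \<le> r" and "r \<le> R" and "R \<le> k"
  defines "C \<equiv> ((R ^ m + k ^ m) / (r ^ m + k ^ m)) powr (real n / real m)"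
  shows "max_modulus p R \<le> C * max_modulus p r - (C - 1) * min_modulus p k"
proof -
  define \<mu> where "\<mu> = min_modulus p k"
  have deg: "degree p = n" and nz: "\<And>z. cmod z < k \<Longrightarrow> poly p z \<noteq> 0"
    using p by (auto simp: lacunary_nonvanishing_def)
  have "0 \<le> R"
    using assms by simp
  then obtain z where z: "cmod z = R" "cmod (poly p z) = max_modulus p R"
    using max_modulus_attained by blast
  obtain u where u: "cmod u = 1" "z = of_real R * u"
    using exists_unit_direction[of z] z(1) by auto
  define y where "y = poly p (of_real r * u)"
  have ru: "cmod (of_real r * u) = r"
    using u assms(5) by (simp add: norm_mult)
  have \<mu>: "0 \<le> \<mu>" "\<mu> \<le> cmod y"
    using min_modulus_nonneg[of k p] min_modulus_le_modulus_cball[OF nz assms(4)] ru assms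
    by (auto simp: \<mu>_def y_def)
  obtain v where v: "cmod v = 1" "y = of_real (cmod y) * v"
    using exists_unit_direction by blast
  define c where "c = of_real \<mu> * v"
  have c: "cmod c = \<mu>"
    using v \<mu> by (simp add: c_def norm_mult)
  have "y - c = of_real (cmod y - \<mu>) * v"
    unfolding c_def by (subst v(2)) (simp add: algebra_simps)
  then have yc: "cmod (y - c) = cmod y - \<mu>"
    using v(1) \<mu> by (simp only: norm_mult norm_of_real) simp
  have "lacunary_nonvanishing n m k (p - [:c:])"
    using poly_ne_of_le_min_modulus[of p k c] nz deg assms c
    by (intro lacunary_nonvanishing_diff_const[OF p]) (auto simp: \<mu>_def)
  from norm_poly_radial_growth[OF this assms(2-7) u(1)]
  have "cmod (poly p z - c) \<le> C * (cmod y - \<mu>)"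
    by (simp add: C_def u(2) yc flip: y_def)
  also have "\<dots> \<le> C * (max_modulus p r - \<mu>)"
    using modulus_le_max_modulus[OF ru, of p] by (intro mult_left_mono) (auto simp: C_def y_def)
  finally have "cmod (poly p z) \<le> C * (max_modulus p r - \<mu>) + \<mu>"
    using norm_triangle_ineq2[of "poly p z" c] c by simp
  then show ?thesis
    using z(2) by (simp add: \<mu>_def algebra_simps)
qed

subsection \<open>The polar derivative\<close>

lemma max_modulus_polar_deriv_le:
  assumes p: "lacunary_nonvanishing n m k p" and "1 \<le> m" and "1 \<le> n" and "0 < k"
    and "0 \<le> R" and "R \<le> k" and \<alpha>: "R \<le> cmod \<alpha>"
  shows "max_modulus (polar_deriv \<alpha> p) R
    \<le> n * (R ^ (m - 1) * cmod \<alpha> + k ^ m) / (R ^ m + k ^ m) * max_modulus p R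
      - n * (R ^ (m - 1) * cmod \<alpha> - R ^ m) / (R ^ m + k ^ m) * min_modulus p k"
proof -
  define M where "M = max_modulus p R"
  define \<mu> where "\<mu> = min_modulus p k"
  have deg: "degree p = n"
    using p by (auto simp: lacunary_nonvanishing_def)
  obtain z where z: "cmod z = R" "cmod (poly (polar_deriv \<alpha> p) z) = max_modulus (polar_deriv \<alpha> p) R"
    using max_modulus_attained[OF assms(5)] by blast
  define A where "A = cmod (of_nat n * poly p z - z * poly (pderiv p) z)"
  define B where "B = cmod (poly (pderiv p) z)"
  define Q where "Q = R ^ (m - 1)"
  have Rm: "R ^ m = R * Q"
    using assms(2) by (simp add: Q_def power_eq_if[of R m])
  have Q: "0 \<le> Q"
    using assms(5) by (simp add: Q_def)
  have den: "0 < R * Q + k ^ m"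
    using assms(4,5) Q by (auto intro: add_nonneg_pos)
  have lower: "k ^ m * B \<le> Q * (A - n * \<mu>)"
    using deriv_bound_min_modulus[OF p assms(2-4), of z] z(1) assms(6)
    by (simp add: A_def B_def Q_def \<mu>_def)
  have upper: "A + R * B \<le> n * M"
    using deriv_add_reciprocal_deriv_le[OF deg assms(3) z(1)] by (simp add: A_def B_def M_def)
  \<comment> \<open>Eliminating \<open>A\<close> between \<open>lower\<close> and
    \<open>upper\<close> bounds \<open>B\<close>.\<close>
  have "Q * A \<le> Q * (n * M - R * B)"
    using Q upper by (intro mult_left_mono) auto
  with lower have B: "(R * Q + k ^ m) * B \<le> n * Q * (M - \<mu>)"
    by (simp add: algebra_simps)
  have "poly (polar_deriv \<alpha> p) z = (of_nat n * poly p z - z * poly (pderiv p) z) + \<alpha> * poly (pderiv p) z"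
    by (simp add: poly_polar_deriv deg algebra_simps)
  then have "max_modulus (polar_deriv \<alpha> p) R \<le> A + cmod \<alpha> * B"
    unfolding z(2)[symmetric] A_def B_def by (metis norm_mult norm_triangle_ineq)
  \<comment> \<open>Trading \<open>A\<close> for n M - R B leaves \<open>B\<close> with a
    coefficient that is nonnegative since |\<alpha>| \<ge> R.\<close>
  also have "\<dots> \<le> n * M + (cmod \<alpha> - R) * B"
    using upper by (simp add: algebra_simps)
  also have "\<dots> \<le> n * M + (cmod \<alpha> - R) * (n * Q * (M - \<mu>) / (R * Q + k ^ m))"
    using B den \<alpha> by (intro add_left_mono mult_left_mono) (auto simp: field_simps)
  also have "\<dots> = n * (Q * cmod \<alpha> + k ^ m) / (R * Q + k ^ m) * M
      - n * (Q * cmod \<alpha> - R * Q) / (R * Q + k ^ m) * \<mu>"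
    using den by (simp add: divide_simps) (simp add: algebra_simps)
  finally show ?thesis
    unfolding M_def \<mu>_def Rm[symmetric] by (simp only: Q_def)
qed

lemma polar_bound_valid:
  assumes p: "lacunary_nonvanishing n m k p" and "1 \<le> m" and "1 \<le> n" and "0 < k"
    and "0 \<le> r" and "r \<le> R" and "R \<le> k" and \<alpha>: "R \<le> cmod \<alpha>"
  shows "max_modulus (polar_deriv \<alpha> p) R \<le> polar_bound n m k r R \<alpha> p"
proof -
  have R: "0 \<le> R"
    using assms by simp
  have "0 \<le> n * (R ^ (m - 1) * cmod \<alpha> + k ^ m) / (R ^ m + k ^ m)"
    using R assms(4) by simp
  from mult_left_mono[OF max_modulus_growth[OF p assms(2-7)] this] show ?thesis
    using max_modulus_polar_deriv_le[OF p assms(2-4) R assms(7) \<alpha>]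
    unfolding polar_bound_def by linarith
qed

subsection \<open>The extremal polynomial\<close>

lemma poly_extremal_poly: "poly (extremal_poly n m k) z = (z ^ m + of_real (k ^ m)) ^ (n div m)"
  by (simp add: extremal_poly_def poly_monom)

lemma lacunary_nonvanishing_extremal_poly:
  assumes "1 \<le> m" and "m dvd n" and "0 < k"
  shows "lacunary_nonvanishing n m k (extremal_poly n m k)"
proof -
  let ?q = "monom 1 m + [:complex_of_real (k ^ m):]"
  have dq: "degree ?q = m"
    using assms(1) by (subst degree_add_eq_left) (auto simp: degree_monom_eq)
  then have "?q \<noteq> 0"
    using assms(1) by (metis degree_0 not_one_le_zero)
  then have "degree (extremal_poly n m k) = n"
    using assms(2) dq by (simp add: extremal_poly_def degree_power_eq)
  moreover have "coeff (extremal_poly n m k) \<nu> = 0" if \<nu>: "0 < \<nu>" "\<nu> < m" for \<nu>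
  proof -
    \<comment> \<open>Multiplying by z^m + k^m only rescales the coefficients below index m.\<close>
    have "\<forall>\<nu>. 0 < \<nu> \<and> \<nu> < m \<longrightarrow> coeff (?q ^ N) \<nu> = 0" for N
    proof (induction N)
      case 0
      show ?case
        by simp
    next
      case (Suc N)
      show ?case
      proof safe
        fix \<nu> assume "0 < \<nu>" "\<nu> < m"
        then show "coeff (?q ^ Suc N) \<nu> = 0"
          using Suc by (simp add: distrib_right coeff_monom_mult)
      qed
    qed
    then show ?thesis
      using \<nu> by (simp add: extremal_poly_def)
  qed
  moreover have "poly (extremal_poly n m k) z \<noteq> 0" if z: "cmod z < k" for z
  proof
    assume "poly (extremal_poly n m k) z = 0"
    then have "z ^ m = - of_real (k ^ m)"
      by (simp add: poly_extremal_poly add_eq_0_iff2)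
    then have "cmod z ^ m = k ^ m"
      using assms(3) by (metis norm_power norm_minus_cancel norm_of_real abs_of_pos zero_less_power)
    moreover have "cmod z ^ m < k ^ m"
      using z assms(1) by (intro power_strict_mono) auto
    ultimately show False
      by simp
  qed
  ultimately show ?thesis
    by (simp add: lacunary_nonvanishing_def)
qed

lemma max_modulus_extremal_poly_le:
  assumes "0 \<le> r" and "0 \<le> k"
  shows "max_modulus (extremal_poly n m k) r \<le> (r ^ m + k ^ m) ^ (n div m)"
proof -
  obtain z where z: "cmod z = r"
    "cmod (poly (extremal_poly n m k) z) = max_modulus (extremal_poly n m k) r"
    using max_modulus_attained[OF assms(1)] by blast
  have "cmod (z ^ m + of_real (k ^ m)) \<le> cmod (z ^ m) + cmod (of_real (k ^ m))"
    by (rule norm_triangle_ineq)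
  also have "\<dots> = r ^ m + k ^ m"
    using z(1) assms(2) by (simp add: norm_power)
  finally have "cmod (z ^ m + of_real (k ^ m)) ^ (n div m) \<le> (r ^ m + k ^ m) ^ (n div m)"
    by (rule power_mono) simp
  then show ?thesis
    using z(2) by (simp only: poly_extremal_poly norm_power)
qed

text \<open>The point z = R is where the bound is attained. As n \<ge> 1 and m divides n, the
  exponent \<open>n div m - 1\<close> is not truncated.\<close>

lemma poly_polar_deriv_extremal_poly:
  assumes "1 \<le> m" and "m dvd n" and "1 \<le> n" and "0 < k"
  shows "poly (polar_deriv (of_real a) (extremal_poly n m k)) (of_real R)
    = of_real (n * (R ^ (m - 1) * a + k ^ m) * (R ^ m + k ^ m) ^ (n div m - 1))"
proof -
  have deg: "degree (extremal_poly n m k) = n"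
    using lacunary_nonvanishing_extremal_poly[OF assms(1,2,4)] by (simp add: lacunary_nonvanishing_def)
  obtain N where N: "n = m * N"
    using assms(2) by blast
  then obtain N' where N': "N = Suc N'"
    using assms(3) by (cases N) auto
  obtain m' where m': "m = Suc m'"
    using assms(1) by (cases m) auto
  have div: "n div m = Suc N'"
    using N N' assms(1) by simp
  show ?thesis
    unfolding poly_polar_deriv deg poly_extremal_poly
    unfolding extremal_poly_def div pderiv_power_Suc
    by (simp add: pderiv_add pderiv_monom pderiv_pCons poly_monom N N' m' algebra_simps)
qed

lemma polar_bound_extremal_poly_le:
  assumes "1 \<le> m" and "m dvd n" and "1 \<le> n" and "0 < k"
    and "0 \<le> r" and "r \<le> R" and "R \<le> a"
  shows "polar_bound n m k r R (of_real a) (extremal_poly n m k)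
    \<le> n * (R ^ (m - 1) * a + k ^ m) * (R ^ m + k ^ m) ^ (n div m - 1)"
proof -
  let ?p = "extremal_poly n m k"
  define N where "N = n div m"
  define C where "C = ((R ^ m + k ^ m) / (r ^ m + k ^ m)) powr (real n / real m)"
  define K where "K = n * (R ^ (m - 1) * a + k ^ m) / (R ^ m + k ^ m)"
  have R: "0 \<le> R"
    using assms by simp
  have pos: "0 < r ^ m + k ^ m" "0 < R ^ m + k ^ m"
    using assms by (auto intro: add_nonneg_pos)
  have "real n / real m = real N"
    using assms(1,2) by (simp add: N_def real_of_nat_div)
  then have C: "C = ((R ^ m + k ^ m) / (r ^ m + k ^ m)) ^ N"
    using pos by (simp add: C_def powr_realpow)
  have "1 \<le> (R ^ m + k ^ m) / (r ^ m + k ^ m)"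
    using pos assms by (simp add: power_mono)
  then have C1: "1 \<le> C"
    unfolding C by (rule one_le_power)
  have K0: "0 \<le> K"
    unfolding K_def using R assms by simp
  have \<mu>: "0 \<le> min_modulus ?p k"
    using min_modulus_nonneg assms by simp
  have "C * max_modulus ?p r - (C - 1) * min_modulus ?p k \<le> C * max_modulus ?p r"
    using C1 \<mu> by simp
  also have "\<dots> \<le> C * (r ^ m + k ^ m) ^ N"
    using max_modulus_extremal_poly_le[of r k n m] C1 assms
    by (intro mult_left_mono) (auto simp: N_def)
  also have "\<dots> = (R ^ m + k ^ m) ^ N"
    unfolding C using pos by (simp add: power_divide)
  finally have "K * (C * max_modulus ?p r - (C - 1) * min_modulus ?p k) \<le> K * (R ^ m + k ^ m) ^ N"
    using K0 by (rule mult_left_mono)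
  moreover have "R ^ m \<le> R ^ (m - 1) * a"
    using assms(1,7) R by (simp add: power_eq_if[of R m] mult.commute mult_right_mono)
  then have "0 \<le> n * (R ^ (m - 1) * a - R ^ m) / (R ^ m + k ^ m) * min_modulus ?p k"
    using \<mu> pos by simp
  moreover have "1 \<le> N"
    using assms(1,2,3) by (auto simp: N_def)
  then have "K * (R ^ m + k ^ m) ^ N
      = n * (R ^ (m - 1) * a + k ^ m) * (R ^ m + k ^ m) ^ (N - 1)"
    using pos unfolding K_def by (simp add: power_eq_if[of _ N])
  moreover have "cmod (of_real a) = a"
    using R assms(7) by simp
  ultimately show ?thesis
    unfolding polar_bound_def C_def K_def N_def by simp
qed

text \<open>Equality is claimed for real a \<ge> R, as it fails for general complex \<alpha>: for m
  = 1 the extremal polar derivative is n (k + \<alpha>) (z + k)^(n - 1), and |k + \<alpha>| < k +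
  |\<alpha>| unless \<alpha> is real and nonnegative.\<close>

theorem theorem2:
  fixes n m :: nat and k r R :: real
  assumes "1 \<le> m" and "m \<le> n" and "1 \<le> k"
    and "0 \<le> r" and "r \<le> R" and "R \<le> k"
  shows "(\<forall>p \<alpha>. lacunary_nonvanishing n m k p \<and> R \<le> cmod \<alpha> \<longrightarrow>
            max_modulus (polar_deriv \<alpha> p) R \<le> polar_bound n m k r R \<alpha> p) \<and>
         (m dvd n \<longrightarrow>
            lacunary_nonvanishing n m k (extremal_poly n m k) \<and>
            (\<forall>a::real. R \<le> a \<longrightarrow>
               max_modulus (polar_deriv (complex_of_real a) (extremal_poly n m k)) R
               = polar_bound n m k r R (complex_of_real a) (extremal_poly n m k)))"
proof (intro conjI allI impI)
  have n: "1 \<le> n" and k: "0 < k" and R: "0 \<le> R"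
    using assms by auto
  show bound: "max_modulus (polar_deriv \<alpha> p) R \<le> polar_bound n m k r R \<alpha> p"
    if "lacunary_nonvanishing n m k p \<and> R \<le> cmod \<alpha>" for p \<alpha>
    using polar_bound_valid[of n m k p r R \<alpha>] that assms n k by auto
  show lac: "lacunary_nonvanishing n m k (extremal_poly n m k)" if "m dvd n"
    using lacunary_nonvanishing_extremal_poly[OF assms(1) that k] .
  show "max_modulus (polar_deriv (complex_of_real a) (extremal_poly n m k)) R
      = polar_bound n m k r R (complex_of_real a) (extremal_poly n m k)"
    if dvd: "m dvd n" and a: "R \<le> a" for a
  \<comment> \<open>One direction is the general bound, the other the value at z = R.\<close>
  proof (rule antisym)
    let ?D = "polar_deriv (complex_of_real a) (extremal_poly n m k)"
    show "max_modulus ?D R \<le> polar_bound n m k r R (complex_of_real a) (extremal_poly n m k)"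
      using bound lac[OF dvd] a R by simp
    have "polar_bound n m k r R (complex_of_real a) (extremal_poly n m k)
        \<le> n * (R ^ (m - 1) * a + k ^ m) * (R ^ m + k ^ m) ^ (n div m - 1)"
      using polar_bound_extremal_poly_le[OF assms(1) dvd n k assms(4,5) a] .
    also have "\<dots> \<le> cmod (poly ?D (of_real R))"
      unfolding poly_polar_deriv_extremal_poly[OF assms(1) dvd n k] norm_of_real by (rule abs_ge_self)
    also have "\<dots> \<le> max_modulus ?D R"
      using R by (intro modulus_le_max_modulus) simp
    finally show "polar_bound n m k r R (complex_of_real a) (extremal_poly n m k) \<le> max_modulus ?D R" .
  qed
qed

end
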